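(* Let $\bar{x}\in\Omega$ be a pw-AKKT solution for (CTP) and let $\{(x^k,u^k,v^k)\}_{k\in\mathbb{N}}$ be an associated AKKT sequence (so that $x^k(t)\to\bar{x}(t)$ for a.e. $t\in[0,T]$). Assume that (H1) and (H2) (stated in the context) are satisfied at $\bar{x}$, that $\{x^k\}_{k\in\mathbb{N}}$ is a bounded sequence in $L^\infty([0,T];\mathbb{R}^n)$, and that $$\sum_{i=1}^{p}u_i^k(t)h_i(x^k(t),t)+\sum_{j=1}^{m}v_j^k(t)g_j(x^k(t),t)\ge 0\quad\text{for a.e. } t\in[0,T],\ \text{for all } k\in\mathbb{N}.$$ If, for a.e. $t\in[0,T]$, the functions $\phi(\cdot,t)$ and $g_j(\cdot,t)$, $j=1,\dots,m$, are convex and the functions $h_i(\cdot,t)$, $i=1,\dots,p$, are affine, then $\bar{x}$ is a global optimal solution of (CTP), i.e. $P(\bar{x})\le P(x)$ for all $x\in\Omega$.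
   Context: Let $T>0$ and let $\phi:\mathbb{R}^n\times[0,T]\to\mathbb{R}$, $h=(h_1,\dots,h_p):\mathbb{R}^n\times[0,T]\to\mathbb{R}^p$, $g=(g_1,\dots,g_m):\mathbb{R}^n\times[0,T]\to\mathbb{R}^m$ be given functions. Integrals are Lebesgue integrals and vector inequalities are componentwise. Problem (CTP) is: minimize $P(x)=\int_0^T\phi(x(t),t)\,dt$ over $x\in L^\infty([0,T];\mathbb{R}^n)$ subject to $h(x(t),t)=0$ and $g(x(t),t)\le 0$ for a.e. $t\in[0,T]$. Its feasible set is $$\Omega=\{x\in L^\infty([0,T];\mathbb{R}^n): h(x(t),t)=0,\ g(x(t),t)\le 0 \text{ a.e. } t\in[0,T]\}.$$ For $\bar{x}\in\Omega$ and $r>0$ put $\bar{B}_r(t)=\{x\in\mathbb{R}^n:\|x-\bar{x}(t)\|\le r\}$. The Lagrangian is $L(x,u,v,t)=\phi(x,t)+\sum_{i=1}^p u_ih_i(x,t)+\sum_{j=1}^m v_jg_j(x,t)$, and $g_j^-(x,t)=\max\{-g_j(x,t),0\}$. The basic assumptions are satisfied at $\bar{x}$ if there exists $r>0$ such that: (H1) $\phi(\cdot,t)$ is continuously differentiable for a.e. $t\in[0,T]$; $\phi(x,\cdot)$ is Lebesgue measurable for each $x$; $|\phi(\bar{x}(\cdot),\cdot)|$ is integrable on $[0,T]$; there is an integrable function $c_\phi$ on $[0,T]$ with $|\phi(x,t)-\phi(y,t)|\le c_\phi(t)\|x-y\|$ for all $x,y\in\bar{B}_r(t)$, a.e. $t\in[0,T]$.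 (H2) $(h,g)(\cdot,t)$ is continuously differentiable for a.e. $t\in[0,T]$; $(h,g)(x,\cdot)$ is Lebesgue measurable for each $x$; $\|(h,g)(\bar{x}(\cdot),\cdot)\|$ is integrable on $[0,T]$; there is an integrable function $c_{h,g}$ on $[0,T]$ with $\|(h,g)(x,t)-(h,g)(y,t)\|\le c_{h,g}(t)\|x-y\|$ for all $x,y\in\bar{B}_r(t)$, a.e. $t\in[0,T]$. A sequence $\{(x^{k},u^{k},v^{k})\}_{k\in\mathbb{N}}\subset L^{\infty}([0,T];\mathbb{R}^{n}\times\mathbb{R}^{p}\times\mathbb{R}^{m})$ is an AKKT sequence for (CTP) if (i) $\int_0^T\nabla_xL(x^k(t),u^k(t),v^k(t),t)\cdot\gamma(t)\,dt\to 0$ for all $\gamma\in L^\infty([0,T];\mathbb{R}^n)$; (ii) $v_j^k(t)g_j^-(x^k(t),t)\to 0$ for a.e. $t\in[0,T]$, $j=1,\dots,m$; (iii) $v_j^k(t)\ge 0$ for a.e. $t\in[0,T]$, $j=1,\dots,m$, and all $k$. A point $\bar{x}\in\Omega$ at which (H1) and (H2) hold is a pw-AKKT solution for (CTP) if there exists an AKKT sequence $\{(x^k,u^k,v^k)\}_{k\in\mathbb{N}}$ for (CTP) with $x^k(t)\to\bar{x}(t)$ for a.e. $t\in[0,T]$; any such sequence is called an associated AKKT sequence. *)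

theory Defs
  imports "HOL-Analysis.Analysis" "HOL-Probability.Essential_Supremum"
begin

(* The data phi, h, g are total functions, but only their values on [0,T] matter: the measure
   is Lebesgue measure on {0..T}. The dimensions n, p, m are the cardinalities of the finite
   index types 'n, 'p, 'm. *)

abbreviation time_measure :: "real \<Rightarrow> real measure" where
  "time_measure T \<equiv> lebesgue_on {0..T}"

definition Linf_norm :: "real \<Rightarrow> (real \<Rightarrow> 'a::euclidean_space) \<Rightarrow> ereal" where
  "Linf_norm T x = esssup (time_measure T) (\<lambda>t. ereal (norm (x t)))"

(* Elements are representatives, not classes modulo equality almost everywhere. *)
definition Linf :: "real \<Rightarrow> (real \<Rightarrow> 'a::euclidean_space) set" where
  "Linf T = {x \<in> borel_measurable (time_measure T). Linf_norm T x < \<infinity>}"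

definition Linf_bounded_seq :: "real \<Rightarrow> (nat \<Rightarrow> real \<Rightarrow> 'a::euclidean_space) \<Rightarrow> bool" where
  "Linf_bounded_seq T x \<longleftrightarrow> (\<forall>k. x k \<in> Linf T) \<and> (\<exists>C::real. \<forall>k. Linf_norm T (x k) \<le> ereal C)"

definition continuously_differentiable ::
    "('a::real_normed_vector \<Rightarrow> 'b::real_normed_vector) \<Rightarrow> bool" where
  "continuously_differentiable f \<longleftrightarrow>
     (\<exists>f' :: 'a \<Rightarrow> 'a \<Rightarrow>\<^sub>L 'b.
        (\<forall>x. (f has_derivative blinfun_apply (f' x)) (at x)) \<and> continuous_on UNIV f')"

definition gradient :: "('a::real_inner \<Rightarrow> real) \<Rightarrow> 'a \<Rightarrow> 'a" where
  "gradient f x = (THE d. GDERIV f x :> d)"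

definition affine_fun :: "('a::real_vector \<Rightarrow> 'b::real_vector) \<Rightarrow> bool" where
  "affine_fun f \<longleftrightarrow> (\<exists>l c. linear l \<and> (\<forall>x. f x = l x + c))"

definition feasible_set ::
    "real \<Rightarrow> (real^'n \<Rightarrow> real \<Rightarrow> real^'p) \<Rightarrow> (real^'n \<Rightarrow> real \<Rightarrow> real^'m) \<Rightarrow> (real \<Rightarrow> real^'n) set" where
  "feasible_set T h g =
     {x \<in> Linf T. AE t in time_measure T. h (x t) t = 0 \<and> g (x t) t \<le> 0}"

(* The Lebesgue integral of phi(x(t),t) in the extended reals, as the difference of the integrals
   of the positive and the negative part: phi(x(t),t) need not be integrable for an arbitrary
   feasible x, and the Bochner integral would then be 0 instead of an infinite value.
   If both parts have infinite integral, the ereal difference is plus infinity. *)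
definition cost :: "real \<Rightarrow> (real^'n \<Rightarrow> real \<Rightarrow> real) \<Rightarrow> (real \<Rightarrow> real^'n) \<Rightarrow> ereal" where
  "cost T \<phi> x =
     enn2ereal (\<integral>\<^sup>+ t. ennreal (\<phi> (x t) t) \<partial>time_measure T)
     - enn2ereal (\<integral>\<^sup>+ t. ennreal (- \<phi> (x t) t) \<partial>time_measure T)"

lemma cost_eq_integral:
  assumes "integrable (time_measure T) (\<lambda>t. \<phi> (x t) t)"
  shows "cost T \<phi> x = ereal (\<integral>t. \<phi> (x t) t \<partial>time_measure T)"
proof -
  have "(\<integral>\<^sup>+ t. ennreal (\<phi> (x t) t) \<partial>time_measure T) < \<infinity>"
    "(\<integral>\<^sup>+ t. ennreal (- \<phi> (x t) t) \<partial>time_measure T) < \<infinity>"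
    using assms by (auto simp: real_integrable_def less_top)
  then obtain r q where
    rq: "0 \<le> r" "0 \<le> q"
    "(\<integral>\<^sup>+ t. ennreal (\<phi> (x t) t) \<partial>time_measure T) = ennreal r"
    "(\<integral>\<^sup>+ t. ennreal (- \<phi> (x t) t) \<partial>time_measure T) = ennreal q"
    by (auto simp: less_top_ennreal)
  then show ?thesis
    using real_lebesgue_integral_def[OF assms] by (simp add: cost_def enn2ereal_ennreal)
qed

definition global_optimal ::
    "real \<Rightarrow> (real^'n \<Rightarrow> real \<Rightarrow> real) \<Rightarrow> (real^'n \<Rightarrow> real \<Rightarrow> real^'p)
      \<Rightarrow> (real^'n \<Rightarrow> real \<Rightarrow> real^'m) \<Rightarrow> (real \<Rightarrow> real^'n) \<Rightarrow> bool" where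
  "global_optimal T \<phi> h g xb \<longleftrightarrow>
     xb \<in> feasible_set T h g \<and> (\<forall>x \<in> feasible_set T h g. cost T \<phi> xb \<le> cost T \<phi> x)"

definition Lagrangian ::
    "(real^'n \<Rightarrow> real \<Rightarrow> real) \<Rightarrow> (real^'n \<Rightarrow> real \<Rightarrow> real^'p) \<Rightarrow> (real^'n \<Rightarrow> real \<Rightarrow> real^'m)
      \<Rightarrow> real^'n \<Rightarrow> real^'p \<Rightarrow> real^'m \<Rightarrow> real \<Rightarrow> real" where
  "Lagrangian \<phi> h g x u v t =
     \<phi> x t + (\<Sum>i\<in>UNIV. u $ i * h x t $ i) + (\<Sum>j\<in>UNIV. v $ j * g x t $ j)"

definition neg_part :: "(real^'n \<Rightarrow> real \<Rightarrow> real^'m) \<Rightarrow> 'm \<Rightarrow> real^'n \<Rightarrow> real \<Rightarrow> real" where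
  "neg_part g j x t = max (- (g x t $ j)) 0"

definition hyp_H1 ::
    "real \<Rightarrow> (real^'n \<Rightarrow> real \<Rightarrow> real) \<Rightarrow> (real \<Rightarrow> real^'n) \<Rightarrow> real \<Rightarrow> bool" where
  "hyp_H1 T \<phi> xb r \<longleftrightarrow>
     (AE t in time_measure T. continuously_differentiable (\<lambda>x. \<phi> x t)) \<and>
     (\<forall>x. \<phi> x \<in> borel_measurable (time_measure T)) \<and>
     integrable (time_measure T) (\<lambda>t. \<bar>\<phi> (xb t) t\<bar>) \<and>
     (\<exists>c. integrable (time_measure T) c \<and>
        (AE t in time_measure T. \<forall>x \<in> cball (xb t) r. \<forall>y \<in> cball (xb t) r.
           \<bar>\<phi> x t - \<phi> y t\<bar> \<le> c t * norm (x - y)))"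

(* The norm on the product type is the Euclidean norm of the concatenated vector. *)
definition hyp_H2 ::
    "real \<Rightarrow> (real^'n \<Rightarrow> real \<Rightarrow> real^'p) \<Rightarrow> (real^'n \<Rightarrow> real \<Rightarrow> real^'m) \<Rightarrow> (real \<Rightarrow> real^'n)
      \<Rightarrow> real \<Rightarrow> bool" where
  "hyp_H2 T h g xb r \<longleftrightarrow>
     (AE t in time_measure T. continuously_differentiable (\<lambda>x. (h x t, g x t))) \<and>
     (\<forall>x. (\<lambda>t. (h x t, g x t)) \<in> borel_measurable (time_measure T)) \<and>
     integrable (time_measure T) (\<lambda>t. norm (h (xb t) t, g (xb t) t)) \<and>
     (\<exists>c. integrable (time_measure T) c \<and>
        (AE t in time_measure T. \<forall>x \<in> cball (xb t) r. \<forall>y \<in> cball (xb t) r.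
           norm ((h x t, g x t) - (h y t, g y t)) \<le> c t * norm (x - y)))"

definition basic_assumptions ::
    "real \<Rightarrow> (real^'n \<Rightarrow> real \<Rightarrow> real) \<Rightarrow> (real^'n \<Rightarrow> real \<Rightarrow> real^'p)
      \<Rightarrow> (real^'n \<Rightarrow> real \<Rightarrow> real^'m) \<Rightarrow> (real \<Rightarrow> real^'n) \<Rightarrow> bool" where
  "basic_assumptions T \<phi> h g xb \<longleftrightarrow> (\<exists>r>0. hyp_H1 T \<phi> xb r \<and> hyp_H2 T h g xb r)"

(* The integrability clause says that the Lebesgue integrals whose limit is taken exist;
   the Bochner integral of a non-integrable function would be 0. *)
definition AKKT_sequence ::
    "real \<Rightarrow> (real^'n \<Rightarrow> real \<Rightarrow> real) \<Rightarrow> (real^'n \<Rightarrow> real \<Rightarrow> real^'p)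
      \<Rightarrow> (real^'n \<Rightarrow> real \<Rightarrow> real^'m)
      \<Rightarrow> (nat \<Rightarrow> real \<Rightarrow> real^'n) \<Rightarrow> (nat \<Rightarrow> real \<Rightarrow> real^'p) \<Rightarrow> (nat \<Rightarrow> real \<Rightarrow> real^'m) \<Rightarrow> bool" where
  "AKKT_sequence T \<phi> h g x u v \<longleftrightarrow>
     (\<forall>k. (\<lambda>t. (x k t, u k t, v k t)) \<in> Linf T) \<and>
     (\<forall>\<gamma> \<in> Linf T.
        (\<forall>k. integrable (time_measure T)
               (\<lambda>t. gradient (\<lambda>y. Lagrangian \<phi> h g y (u k t) (v k t) t) (x k t) \<bullet> \<gamma> t)) \<and>
        (\<lambda>k. \<integral>t. gradient (\<lambda>y. Lagrangian \<phi> h g y (u k t) (v k t) t) (x k t) \<bullet> \<gamma> t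
               \<partial>time_measure T) \<longlonglongrightarrow> 0) \<and>
     (\<forall>j. AE t in time_measure T. (\<lambda>k. v k t $ j * neg_part g j (x k t) t) \<longlonglongrightarrow> 0) \<and>
     (\<forall>k j. AE t in time_measure T. v k t $ j \<ge> 0)"

definition associated_AKKT_sequence ::
    "real \<Rightarrow> (real^'n \<Rightarrow> real \<Rightarrow> real) \<Rightarrow> (real^'n \<Rightarrow> real \<Rightarrow> real^'p)
      \<Rightarrow> (real^'n \<Rightarrow> real \<Rightarrow> real^'m) \<Rightarrow> (real \<Rightarrow> real^'n)
      \<Rightarrow> (nat \<Rightarrow> real \<Rightarrow> real^'n) \<Rightarrow> (nat \<Rightarrow> real \<Rightarrow> real^'p) \<Rightarrow> (nat \<Rightarrow> real \<Rightarrow> real^'m) \<Rightarrow> bool" where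
  "associated_AKKT_sequence T \<phi> h g xb x u v \<longleftrightarrow>
     AKKT_sequence T \<phi> h g x u v \<and>
     (AE t in time_measure T. (\<lambda>k. x k t) \<longlonglongrightarrow> xb t)"

definition pw_AKKT_solution ::
    "real \<Rightarrow> (real^'n \<Rightarrow> real \<Rightarrow> real) \<Rightarrow> (real^'n \<Rightarrow> real \<Rightarrow> real^'p)
      \<Rightarrow> (real^'n \<Rightarrow> real \<Rightarrow> real^'m) \<Rightarrow> (real \<Rightarrow> real^'n) \<Rightarrow> bool" where
  "pw_AKKT_solution T \<phi> h g xb \<longleftrightarrow>
     xb \<in> feasible_set T h g \<and> basic_assumptions T \<phi> h g xb \<and>
     (\<exists>x u v. associated_AKKT_sequence T \<phi> h g xb x u v)"

end

theory Submission
  imports Defs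
begin

text \<open>For feasible \<open>w\<close>, convexity of the Lagrangian gives
  \<open>\<phi>(w) \<ge> \<phi>(x\<^sup>k) + \<nabla>L\<^sup>k \<bullet> (w - x\<^sup>k)\<close> almost everywhere. The gradients \<open>\<nabla>L\<^sup>k\<close> converge weakly to 0
  in L1, hence are bounded in L1. On a set where \<open>x\<^sup>k \<rightarrow> xb\<close> uniformly (Egorov), the integrals of
  \<open>\<nabla>L\<^sup>k \<bullet> (w - x\<^sup>k)\<close> therefore tend to 0 over every measurable subset, so the limes superior of
  this product is nonnegative almost everywhere. Consequently \<open>\<phi>(w(t),t) \<ge> \<phi>(xb(t),t)\<close> holds
  almost everywhere.\<close>

subsection \<open>Bounded test functions and uniform boundedness in L1\<close>

text \<open>Hoelder's inequality for the exponents 1 and infinity, obtained by integrating the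
  pointwise Cauchy-Schwarz inequality.\<close>

lemma integrable_inner_ess_bounded:
  fixes f \<gamma> :: "'a \<Rightarrow> 'b::euclidean_space"
  assumes f: "integrable M f" and \<gamma>: "\<gamma> \<in> borel_measurable M"
    and bound: "AE t in M. norm (\<gamma> t) \<le> C"
  shows "integrable M (\<lambda>t. f t \<bullet> \<gamma> t)"
    and "\<bar>\<integral>t. f t \<bullet> \<gamma> t \<partial>M\<bar> \<le> C * (\<integral>t. norm (f t) \<partial>M)"
proof -
  have le: "AE t in M. norm (f t \<bullet> \<gamma> t) \<le> C * norm (f t)"
    using bound
  proof eventually_elim
    case (elim t)
    have "norm (f t \<bullet> \<gamma> t) \<le> norm (\<gamma> t) * norm (f t)"
      using Cauchy_Schwarz_ineq2[of "f t" "\<gamma> t"] by (simp add: mult.commute)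
    also have "\<dots> \<le> C * norm (f t)"
      using elim by (intro mult_right_mono) auto
    finally show ?case .
  qed
  have int: "integrable M (\<lambda>t. C * norm (f t))"
    using f by auto
  have [measurable]: "f \<in> borel_measurable M" "\<gamma> \<in> borel_measurable M"
    using f \<gamma> by auto
  show *: "integrable M (\<lambda>t. f t \<bullet> \<gamma> t)"
  proof (rule Bochner_Integration.integrable_bound[OF int])
    show "AE t in M. norm (f t \<bullet> \<gamma> t) \<le> norm (C * norm (f t))"
      using le by eventually_elim auto
  qed measurable
  have "\<bar>\<integral>t. f t \<bullet> \<gamma> t \<partial>M\<bar> \<le> (\<integral>t. norm (f t \<bullet> \<gamma> t) \<partial>M)"
    using integral_norm_bound[of M "\<lambda>t. f t \<bullet> \<gamma> t"] by simp
  also have "\<dots> \<le> (\<integral>t. C * norm (f t) \<partial>M)"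
    using le by (intro integral_mono_AE int integrable_norm *) auto
  finally show "\<bar>\<integral>t. f t \<bullet> \<gamma> t \<partial>M\<bar> \<le> C * (\<integral>t. norm (f t) \<partial>M)"
    by simp
qed

text \<open>Sokal's gliding hump: were the norms unbounded, a suitable series of terms
  \<open>\<plusminus>(1/3)^n sgn f\<^sub>k\<close> would be a bounded test function with unbounded pairings. The sign of each
  term is chosen so that adding it does not cancel against the preceding partial sum.\<close>

lemma L1_bounded_if_weakly_bounded:
  fixes f :: "nat \<Rightarrow> 'a \<Rightarrow> 'b::euclidean_space"
  assumes f: "\<And>k. integrable M (f k)"
    and weak: "\<And>\<gamma> C. \<gamma> \<in> borel_measurable M \<Longrightarrow> (\<And>t. norm (\<gamma> t) \<le> C) \<Longrightarrow>
                 Bseq (\<lambda>k. \<integral>t. f k t \<bullet> \<gamma> t \<partial>M)"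
  shows "\<exists>B. \<forall>k. (\<integral>t. norm (f k t) \<partial>M) \<le> B"
proof (rule ccontr)
  assume "\<not> ?thesis"
  \<comment> \<open>Growth \<open>4 ^ n\<close> is played off against coefficients
    \<open>(1/3) ^ n\<close>: the coefficients are summable, yet the products
    \<open>(4/3) ^ n\<close> are unbounded.\<close>
  then have "\<forall>n. \<exists>k. (\<integral>t. norm (f k t) \<partial>M) > 4 ^ n"
    by (meson linorder_not_le)
  then obtain \<kappa> where \<kappa>: "\<And>n. (\<integral>t. norm (f (\<kappa> n) t) \<partial>M) > 4 ^ n"
    by metis
  define N where "N n = (\<integral>t. norm (f (\<kappa> n) t) \<partial>M)" for n
  define I where "I n \<gamma> = (\<integral>t. f (\<kappa> n) t \<bullet> \<gamma> t \<partial>M)" for n and \<gamma> :: "'a \<Rightarrow> 'b"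
  define c :: "nat \<Rightarrow> real" where "c n = (1/3) ^ n" for n
  define y where "y n t = c n *\<^sub>R sgn (f (\<kappa> n) t)" for n t
  \<comment> \<open>The pairings of \<open>f (\<kappa> n)\<close> with the two candidates, plus and
    minus \<open>y n\<close>, differ by \<open>2 * I n (y n) = 2 * c n * N n\<close>. Hence at least
    one of them has absolute value \<open>c n * N n\<close> or more, and the recursion selects such
    a one.\<close>
  define S where "S = rec_nat (\<lambda>_. 0) (\<lambda>n s.
      if \<bar>I n (\<lambda>t. s t + y n t)\<bar> \<ge> c n * N n then (\<lambda>t. s t + y n t) else (\<lambda>t. s t - y n t))"
  have S0: "S 0 = (\<lambda>_. 0)"
    by (simp add: S_def)
  have SSuc: "S (Suc n) = (if \<bar>I n (\<lambda>t. S n t + y n t)\<bar> \<ge> c n * N n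
      then (\<lambda>t. S n t + y n t) else (\<lambda>t. S n t - y n t))" for n
    by (simp add: S_def)
  have [measurable]: "f k \<in> borel_measurable M" for k
    using f by auto
  have ymeas [measurable]: "y n \<in> borel_measurable M" for n
    unfolding y_def by measurable
  have Smeas [measurable]: "S n \<in> borel_measurable M" for n
  proof (induction n)
    case (Suc n)
    then have [measurable]: "S n \<in> borel_measurable M" .
    show ?case by (simp add: SSuc)
  qed (simp add: S0)
  have cpos: "c n > 0" for n
    by (simp add: c_def)
  have y_le: "norm (y n t) \<le> c n" for n t
    using cpos[of n] by (simp add: y_def norm_sgn)
  have diff_le: "norm (S (Suc n) t - S n t) \<le> c n" for n t
    using y_le[of n t] by (simp add: SSuc)
  have c_sums: "(\<lambda>i. c (i + n)) sums (c n * (3/2))" for n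
  proof -
    have "(\<lambda>i. c n * (1/3) ^ i) sums (c n * (1 / (1 - 1/3)))"
      by (intro sums_mult geometric_sums) auto
    then show ?thesis by (simp add: c_def power_add mult.commute)
  qed
  have diff_summable: "summable (\<lambda>i. S (Suc (i + n)) t - S (i + n) t)" for n t
    using diff_le by (intro summable_comparison_test[OF _ sums_summable[OF c_sums[of n]]]) auto
  define \<gamma> where "\<gamma> t = (\<Sum>i. S (Suc i) t - S i t)" for t
  have [measurable]: "\<gamma> \<in> borel_measurable M"
    unfolding \<gamma>_def by measurable
  have \<gamma>_S: "norm (\<gamma> t - S n t) \<le> c n * (3/2)" for n t
  proof -
    have "\<gamma> t = (\<Sum>i. S (Suc (i + n)) t - S (i + n) t) + (\<Sum>i<n. S (Suc i) t - S i t)"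
      unfolding \<gamma>_def using suminf_split_initial_segment[OF diff_summable[of 0 t, simplified], of n]
      by simp
    also have "(\<Sum>i<n. S (Suc i) t - S i t) = S n t"
      by (induction n) (simp_all add: S0)
    finally have "\<gamma> t - S n t = (\<Sum>i. S (Suc (i + n)) t - S (i + n) t)"
      by simp
    also have "norm \<dots> \<le> (\<Sum>i. c (i + n))"
      using diff_le by (intro norm_suminf_le sums_summable[OF c_sums]) auto
    also have "\<dots> = c n * (3/2)"
      using c_sums sums_unique by metis
    finally show ?thesis .
  qed
  have \<gamma>_le: "norm (\<gamma> t) \<le> 3/2" for t
    using \<gamma>_S[of t 0] by (simp add: S0 c_def)
  have S_le: "norm (S n t) \<le> 3/2 + c n * (3/2)" for n t
    using norm_triangle_ineq4[of "\<gamma> t" "\<gamma> t - S n t"] \<gamma>_le[of t] \<gamma>_S[of t n] by simp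
  have int: "integrable M (\<lambda>t. f (\<kappa> n) t \<bullet> \<delta> t)"
    if "\<delta> \<in> borel_measurable M" "\<And>t. norm (\<delta> t) \<le> C" for n C \<delta>
    using integrable_inner_ess_bounded(1)[OF f that(1)] that(2) by blast
  have int_S: "integrable M (\<lambda>t. f (\<kappa> n) t \<bullet> S m t)"
    and int_y: "integrable M (\<lambda>t. f (\<kappa> n) t \<bullet> y m t)" for n m
    using int[OF Smeas S_le] int[OF ymeas y_le] by auto
  have Iy: "I n (y n) = c n * N n" for n
  proof -
    have "f (\<kappa> n) t \<bullet> y n t = c n * norm (f (\<kappa> n) t)" for t
      by (simp add: y_def sgn_div_norm power2_norm_eq_inner[symmetric] power2_eq_square field_simps)
    then show ?thesis by (simp add: I_def N_def)
  qed
  have I_S: "\<bar>I n (S (Suc n))\<bar> \<ge> c n * N n" for n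
  proof (cases "\<bar>I n (\<lambda>t. S n t + y n t)\<bar> \<ge> c n * N n")
    case False
    have "I n (\<lambda>t. S n t + y n t) = I n (S n) + I n (y n)"
      "I n (\<lambda>t. S n t - y n t) = I n (S n) - I n (y n)"
      unfolding I_def using int_S int_y by (simp_all add: inner_add_right inner_diff_right)
    with False Iy[of n] show ?thesis
      by (simp add: SSuc)
  qed (simp add: SSuc)
  have I_\<gamma>: "\<bar>I n \<gamma>\<bar> \<ge> (4/3) ^ n / 2" for n
  proof -
    \<comment> \<open>The ratio 1/3 matters here: the tail after stage \<open>n\<close> is at most
      \<open>c (Suc n) * (3/2) = c n / 2\<close>, so it destroys at most half of the pairing
      \<open>c n * N n\<close> secured by \<open>I_S\<close>.\<close>
    have dle: "norm (\<gamma> t - S (Suc n) t) \<le> c n / 2" for t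
      using \<gamma>_S[of t "Suc n"] by (simp add: c_def)
    have "I n \<gamma> - I n (S (Suc n)) = (\<integral>t. f (\<kappa> n) t \<bullet> (\<gamma> t - S (Suc n) t) \<partial>M)"
      unfolding I_def using int[OF \<open>\<gamma> \<in> borel_measurable M\<close> \<gamma>_le] int_S
      by (simp add: inner_diff_right)
    also have "\<bar>\<dots>\<bar> \<le> c n / 2 * N n"
      unfolding N_def using dle by (intro integrable_inner_ess_bounded f) auto
    finally have "\<bar>I n \<gamma>\<bar> \<ge> c n * N n / 2"
      using I_S[of n] by (smt (verit) field_sum_of_halves times_divide_eq_left)
    moreover have "c n * N n \<ge> c n * 4 ^ n"
      using \<kappa>[of n] cpos[of n] by (simp add: N_def)
    moreover have "c n * 4 ^ n = (4/3) ^ n"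
      by (simp add: c_def power_mult_distrib[symmetric])
    ultimately show ?thesis by simp
  qed
  \<comment> \<open>The single function \<open>\<gamma>\<close> is an admissible test function, so
    its pairings are bounded, whereas \<open>I_\<gamma>\<close> makes them grow geometrically along
    \<open>\<kappa>\<close>.\<close>
  obtain B where B: "\<And>k. norm (\<integral>t. f k t \<bullet> \<gamma> t \<partial>M) \<le> B"
    using weak[OF \<open>\<gamma> \<in> borel_measurable M\<close> \<gamma>_le] unfolding Bseq_def by blast
  obtain n where "2 * B < (4/3) ^ n"
    using real_arch_pow[of "4/3" "2 * B"] by auto
  with I_\<gamma>[of n] B[of "\<kappa> n"] show False
    by (simp add: I_def)
qed

subsection \<open>Egorov's theorem and weakly null sequences\<close>

text \<open>For fixed \<open>n\<close> the sets \<open>A n j\<close> decrease in \<open>j\<close> to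
  a null set, so by finiteness of the measure one of them is as small as desired. Discarding one
  such set for every \<open>n\<close> leaves a set on which the rate of convergence no longer
  depends on the point.\<close>

theorem (in finite_measure) Egorov:
  fixes f :: "nat \<Rightarrow> 'a \<Rightarrow> 'b::{metric_space, second_countable_topology}"
  assumes [measurable]: "\<And>k. f k \<in> borel_measurable M" "l \<in> borel_measurable M"
    and lim: "AE t in M. (\<lambda>k. f k t) \<longlonglongrightarrow> l t" and "e > 0"
  shows "\<exists>E\<in>sets M. measure M (space M - E) < e \<and> uniform_limit E f l sequentially"
proof -
  define A where "A n j = {t \<in> space M. \<exists>k\<ge>j. 1 / real (Suc n) \<le> dist (f k t) (l t)}" for n j
  have [measurable]: "A n j \<in> sets M" for n j
    unfolding A_def by measurable
  \<comment> \<open>These bounds add up to \<open>e / 2\<close>, which leaves room for the strict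
    inequality \<open>< e\<close>.\<close>
  have "\<exists>j. measure M (A n j) < e / 2 * (1/2) ^ Suc n" for n
  proof -
    have "AE t in M. t \<notin> (\<Inter>j. A n j)"
      using lim
    proof eventually_elim
      case (elim t)
      then have "eventually (\<lambda>k. dist (f k t) (l t) < 1 / real (Suc n)) sequentially"
        by (rule tendstoD) simp
      then obtain j where "\<And>k. k \<ge> j \<Longrightarrow> dist (f k t) (l t) < 1 / real (Suc n)"
        by (auto simp: eventually_sequentially)
      then have "t \<notin> A n j"
        by (force simp: A_def)
      then show ?case by auto
    qed
    then have "measure M (\<Inter>j. A n j) = 0"
      by (subst measure_eq_0_null_sets) (auto intro!: AE_iff_null_sets[THEN iffD2])
    moreover have "(\<lambda>j. measure M (A n j)) \<longlonglongrightarrow> measure M (\<Inter>j. A n j)"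
      by (rule finite_Lim_measure_decseq) (auto simp: decseq_def A_def intro: order_trans)
    ultimately have "(\<lambda>j. measure M (A n j)) \<longlonglongrightarrow> 0" by simp
    then have "eventually (\<lambda>j. measure M (A n j) < e / 2 * (1/2) ^ Suc n) sequentially"
      using \<open>e > 0\<close> by (intro order_tendstoD) auto
    then show ?thesis
      by (auto simp: eventually_sequentially)
  qed
  then obtain J where J: "\<And>n. measure M (A n (J n)) < e / 2 * (1/2) ^ Suc n"
    by metis
  define E where "E = space M - (\<Union>n. A n (J n))"
  have sums: "(\<lambda>n. e / 2 * (1/2) ^ Suc n) sums (e / 2 * 1)"
    by (intro sums_mult power_half_series)
  have summ: "summable (\<lambda>n. measure M (A n (J n)))"
    using J by (intro summable_comparison_test[OF _ sums_summable[OF sums]])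
      (auto intro!: exI[of _ 0] less_imp_le)
  have "space M - E = (\<Union>n. A n (J n))"
    by (auto simp: E_def A_def)
  also have "measure M \<dots> \<le> (\<Sum>n. measure M (A n (J n)))"
    by (intro finite_measure_subadditive_countably summ) auto
  also have "\<dots> \<le> (\<Sum>n. e / 2 * (1/2) ^ Suc n)"
    using J by (intro suminf_le summ sums_summable[OF sums]) (auto intro: less_imp_le)
  also have "\<dots> < e"
    using sums_unique[OF sums] \<open>e > 0\<close> by simp
  finally have "measure M (space M - E) < e" .
  moreover have "uniform_limit E f l sequentially"
  proof (rule uniform_limitI)
    fix d :: real assume "d > 0"
    then obtain n where n: "1 / real (Suc n) < d"
      using nat_approx_posE by blast
    have "dist (f k t) (l t) < d" if "k \<ge> J n" "t \<in> E" for k t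
    proof -
      have "t \<notin> A n (J n)" "t \<in> space M"
        using that by (auto simp: E_def)
      then show ?thesis
        using that(1) n by (force simp: A_def)
    qed
    then show "\<forall>\<^sub>F k in sequentially. \<forall>t\<in>E. dist (f k t) (l t) < d"
      by (auto simp: eventually_sequentially)
  qed
  moreover have "E \<in> sets M"
    unfolding E_def by measurable
  ultimately show ?thesis by blast
qed

text \<open>If the claim failed, the products would be at most \<open>- d\<close> from some index
  on, throughout a set of positive measure. On a smaller set \<open>G\<close> of positive measure
  \<open>y k\<close> tends to 0 uniformly, so the integrals over \<open>G\<close> tend to 0: the
  \<open>z\<close> part by weak convergence, the \<open>y k\<close> part by the L1 bound on
  \<open>f k\<close>. Yet they are at most \<open>- d * measure M G\<close>.\<close>

lemma (in finite_measure) weakly_null_limsup_nonneg: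
  fixes f y :: "nat \<Rightarrow> 'a \<Rightarrow> 'b::euclidean_space"
  assumes f: "\<And>k. integrable M (f k)"
    and weak: "\<And>\<gamma> C. \<gamma> \<in> borel_measurable M \<Longrightarrow> AE t in M. norm (\<gamma> t) \<le> C \<Longrightarrow>
                 (\<lambda>k. \<integral>t. f k t \<bullet> \<gamma> t \<partial>M) \<longlonglongrightarrow> 0"
    and z: "z \<in> borel_measurable M" "AE t in M. norm (z t) \<le> C"
    and y: "\<And>k. y k \<in> borel_measurable M" "\<And>k. AE t in M. norm (y k t) \<le> D k"
    and lim: "AE t in M. (\<lambda>k. y k t) \<longlonglongrightarrow> 0"
  shows "AE t in M. \<forall>d>0. \<exists>\<^sub>F k in sequentially. f k t \<bullet> (z t + y k t) > - d"
proof -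
  define b where "b k t = f k t \<bullet> (z t + y k t)" for k t
  have [measurable]: "f k \<in> borel_measurable M" "y k \<in> borel_measurable M"
    "z \<in> borel_measurable M" for k
    using f y z by auto
  have [measurable]: "b k \<in> borel_measurable M" for k
    unfolding b_def by measurable
  have "\<exists>B. \<forall>k. (\<integral>t. norm (f k t) \<partial>M) \<le> B"
  proof (rule L1_bounded_if_weakly_bounded[OF f])
    fix \<gamma> :: "'a \<Rightarrow> 'b" and C
    assume "\<gamma> \<in> borel_measurable M" "\<And>t. norm (\<gamma> t) \<le> C"
    then have "(\<lambda>k. \<integral>t. f k t \<bullet> \<gamma> t \<partial>M) \<longlonglongrightarrow> 0"
      by (intro weak) auto
    then show "Bseq (\<lambda>k. \<integral>t. f k t \<bullet> \<gamma> t \<partial>M)"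
      by (intro convergent_imp_Bseq convergentI)
  qed
  then obtain B where B: "\<And>k. (\<integral>t. norm (f k t) \<partial>M) \<le> B" by blast
  have null: "AE t in M. \<exists>k\<ge>N. b k t > - d" if "d > 0" for N d
  proof -
    define A where "A = {t \<in> space M. \<forall>k\<ge>N. b k t \<le> - d}"
    have [measurable]: "A \<in> sets M"
      unfolding A_def by measurable
    have "measure M A = 0"
    proof (rule ccontr)
      assume "measure M A \<noteq> 0"
      then have "measure M A > 0"
        by (simp add: zero_less_measure_iff)
      \<comment> \<open>The exceptional set is taken smaller than \<open>A\<close>, so that
        \<open>A\<close> still meets \<open>E\<close> in positive measure.\<close>
      then obtain E where [measurable]: "E \<in> sets M"
        and E: "measure M (space M - E) < measure M A" "uniform_limit E y (\<lambda>_. 0) sequentially"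
        using Egorov[of y "\<lambda>_. 0" "measure M A"] lim by auto
      define G where "G = A \<inter> E"
      have [measurable]: "G \<in> sets M" by (simp add: G_def)
      have "measure M A \<le> measure M (G \<union> (space M - E))"
        using sets.sets_into_space[OF \<open>A \<in> sets M\<close>]
        by (intro finite_measure_mono) (auto simp: G_def)
      also have "\<dots> \<le> measure M G + measure M (space M - E)"
        by (intro measure_Un_le) auto
      finally have G_pos: "measure M G > 0"
        using E by simp
      define I where "I k = (\<integral>t. f k t \<bullet> (indicator G t *\<^sub>R z t) \<partial>M)" for k
      define R where "R k = (\<integral>t. f k t \<bullet> (indicator G t *\<^sub>R y k t) \<partial>M)" for k
      have Gz: "AE t in M. norm (indicator G t *\<^sub>R z t) \<le> C"
        using z(2)
      proof eventually_elim
        case (elim t)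
        \<comment> \<open>Off \<open>G\<close> the claim reads \<open>0 \<le> C\<close>, which
          follows from the norm bound at the same point.\<close>
        then show ?case
          using order_trans[OF norm_ge_zero elim] by (simp add: indicator_def)
      qed
      have "I \<longlonglongrightarrow> 0"
        unfolding I_def using Gz by (intro weak) auto
      moreover have "R \<longlonglongrightarrow> 0"
      proof (rule LIMSEQ_I)
        fix e :: real assume "e > 0"
        \<comment> \<open>The absolute value and the summand 1 make the denominator positive and
          strictly larger than \<open>\<bar>B\<bar>\<close>, whence
          \<open>e' * \<bar>B\<bar> < e\<close>.\<close>
        define e' where "e' = e / (\<bar>B\<bar> + 1)"
        have "e' > 0" using \<open>e > 0\<close> by (simp add: e'_def)
        then have "\<forall>\<^sub>F k in sequentially. \<forall>t\<in>E. norm (y k t) < e'"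
          using uniform_limitD[OF E(2)] by simp
        then obtain K where K: "\<And>k t. k \<ge> K \<Longrightarrow> t \<in> E \<Longrightarrow> norm (y k t) < e'"
          by (auto simp: eventually_sequentially)
        have "norm (R k - 0) < e" if "k \<ge> K" for k
        proof -
          have "\<bar>R k\<bar> \<le> e' * (\<integral>t. norm (f k t) \<partial>M)"
            unfolding R_def
          proof (intro integrable_inner_ess_bounded f)
            show "AE t in M. norm (indicator G t *\<^sub>R y k t) \<le> e'"
              using K[OF that] \<open>e' > 0\<close> by (auto simp: indicator_def G_def intro: less_imp_le)
          qed measurable
          also have "\<dots> \<le> e' * \<bar>B\<bar>"
            using B[of k] \<open>e' > 0\<close> by (intro mult_left_mono) auto
          also have "\<dots> < e"
            using \<open>e > 0\<close> by (simp add: e'_def field_simps)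
          finally show ?thesis by simp
        qed
        then show "\<exists>K. \<forall>k\<ge>K. norm (R k - 0) < e" by blast
      qed
      ultimately have "(\<lambda>k. I k + R k) \<longlonglongrightarrow> 0"
        using tendsto_add by fastforce
      moreover have "I k + R k \<le> - d * measure M G" if "k \<ge> N" for k
      proof -
        have Gy: "AE t in M. norm (indicator G t *\<^sub>R y k t) \<le> D k"
          using y(2)[of k]
        proof eventually_elim
          case (elim t)
          then show ?case
            using order_trans[OF norm_ge_zero elim] by (simp add: indicator_def)
        qed
        have ints: "integrable M (\<lambda>t. f k t \<bullet> (indicator G t *\<^sub>R z t))"
          "integrable M (\<lambda>t. f k t \<bullet> (indicator G t *\<^sub>R y k t))"
          by (intro integrable_inner_ess_bounded(1)[OF f _ Gz] integrable_inner_ess_bounded(1)[OF f _ Gy];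
              measurable)+
        have "I k + R k = (\<integral>t. f k t \<bullet> (indicator G t *\<^sub>R z t) + f k t \<bullet> (indicator G t *\<^sub>R y k t) \<partial>M)"
          unfolding I_def R_def using ints by simp
        \<comment> \<open>On \<open>G\<close> the integrand is \<open>b k t\<close>, at most
          \<open>- d\<close> because \<open>G\<close> lies in \<open>A\<close>; off \<open>G\<close>
          both summands vanish.\<close>
        also have "\<dots> \<le> (\<integral>t. - d * indicator G t \<partial>M)"
        proof (rule integral_mono)
          show "integrable M (\<lambda>t. - d * indicator G t)"
            by (simp add: less_top[symmetric])
          fix t
          show "f k t \<bullet> (indicator G t *\<^sub>R z t) + f k t \<bullet> (indicator G t *\<^sub>R y k t)
              \<le> - d * indicator G t"
            using that by (auto simp: indicator_def G_def A_def b_def inner_add_right)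
        qed (use ints in simp)
        also have "\<dots> = - d * measure M G" by simp
        finally show ?thesis .
      qed
      ultimately have "0 \<le> - d * measure M G"
        by (intro LIMSEQ_le_const2[where X = "\<lambda>k. I k + R k"]) auto
      then show False
        using G_pos \<open>d > 0\<close> by (simp add: mult_le_0_iff)
    qed
    then have "AE t in M. t \<notin> A"
      by (intro AE_not_in) (simp add: null_sets_def emeasure_eq_measure)
    then show ?thesis
      using AE_space by eventually_elim (auto simp: A_def not_le)
  qed
  \<comment> \<open>Replacing all \<open>d > 0\<close> by the countable family
    \<open>1 / real (Suc m)\<close> keeps the union of the exceptional sets null.\<close>
  have "AE t in M. \<forall>m N. \<exists>k\<ge>N. b k t > - (1 / real (Suc m))"
    unfolding AE_all_countable by (intro allI null) simp
  then show ?thesis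
  proof eventually_elim
    case (elim t)
    show ?case
    proof (intro allI impI)
      fix d :: real assume "d > 0"
      then obtain m where m: "1 / real (Suc m) < d"
        using nat_approx_posE by blast
      show "\<exists>\<^sub>F k in sequentially. f k t \<bullet> (z t + y k t) > - d"
        unfolding frequently_sequentially
      proof
        fix N
        obtain k where "k \<ge> N" "b k t > - (1 / real (Suc m))"
          using elim by blast
        with m show "\<exists>k\<ge>N. f k t \<bullet> (z t + y k t) > - d"
          by (intro exI[of _ k]) (simp add: b_def)
      qed
    qed
  qed
qed

subsection \<open>Convexity and the Lagrangian\<close>

text \<open>The Riesz vector of the derivative is written out in the basis. Since
  \<open>gradient\<close> is a definite description, uniqueness of this vector is needed as well as
  existence.\<close>

lemma gradient_has_derivative:
  fixes f :: "'a::euclidean_space \<Rightarrow> real"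
  assumes "f differentiable (at x)"
  shows "(f has_derivative (\<lambda>w. gradient f x \<bullet> w)) (at x)"
proof -
  obtain D where D: "(f has_derivative D) (at x)"
    using assms by (auto simp: differentiable_def)
  interpret D: linear D
    using D by (rule has_derivative_linear)
  define d where "d = (\<Sum>b\<in>Basis. D b *\<^sub>R b)"
  have D_eq: "D = inner d"
  proof
    fix w
    have "D w = D (\<Sum>b\<in>Basis. (w \<bullet> b) *\<^sub>R b)"
      by (simp add: euclidean_representation)
    also have "\<dots> = d \<bullet> w"
      by (simp add: D.sum D.scale d_def inner_sum_left inner_commute[of w] mult.commute)
    finally show "D w = d \<bullet> w" .
  qed
  also have "\<dots> = (\<lambda>w. w \<bullet> d)"
    by (simp add: fun_eq_iff inner_commute)
  finally have d: "GDERIV f x :> d"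
    using D by (simp add: gderiv_def)
  have "e = d" if "GDERIV f x :> e" for e
  proof -
    have "(\<lambda>w. w \<bullet> e) = (\<lambda>w. w \<bullet> d)"
      using that d unfolding gderiv_def by (rule has_derivative_unique)
    then have "w \<bullet> (e - d) = 0" for w
      by (simp add: inner_diff_right fun_eq_iff)
    then show ?thesis
      by (metis inner_eq_zero_iff right_minus_eq)
  qed
  then have "gradient f x = d"
    unfolding gradient_def using d by blast
  then show ?thesis
    using D D_eq by simp
qed

text \<open>Restriction to the line through \<open>x\<close> and \<open>y\<close> reduces the claim
  to the tangent inequality in one variable, between the parameters 0 and 1.\<close>

lemma convex_on_gradient_le:
  fixes f :: "'a::euclidean_space \<Rightarrow> real"
  assumes cvx: "convex_on UNIV f" and diff: "f differentiable (at x)"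
  shows "f x + gradient f x \<bullet> (y - x) \<le> f y"
proof -
  define F where "F s = f (x + s *\<^sub>R (y - x))" for s
  have "convex_on UNIV F"
  proof (rule convex_onI)
    fix t a b :: real assume t: "0 < t" "t < 1"
    have "F ((1 - t) *\<^sub>R a + t *\<^sub>R b)
        = f ((1 - t) *\<^sub>R (x + a *\<^sub>R (y - x)) + t *\<^sub>R (x + b *\<^sub>R (y - x)))"
      unfolding F_def by (rule arg_cong[where f = f]) (simp add: algebra_simps)
    also have "\<dots> \<le> (1 - t) * F a + t * F b"
      unfolding F_def using t by (intro convex_onD[OF cvx]) auto
    finally show "F ((1 - t) *\<^sub>R a + t *\<^sub>R b) \<le> (1 - t) * F a + t * F b" .
  qed simp
  moreover have "(F has_field_derivative (gradient f x \<bullet> (y - x))) (at 0 within UNIV)"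
  proof -
    have "((\<lambda>s. x + s *\<^sub>R (y - x)) has_derivative (\<lambda>s. s *\<^sub>R (y - x))) (at 0)"
      by (auto intro!: derivative_eq_intros)
    moreover have "(f has_derivative (\<lambda>w. gradient f x \<bullet> w)) (at (x + 0 *\<^sub>R (y - x)))"
      using gradient_has_derivative[OF diff] by simp
    ultimately have "(F has_derivative (\<lambda>s. gradient f x \<bullet> (s *\<^sub>R (y - x)))) (at 0)"
      unfolding F_def by (rule has_derivative_compose)
    moreover have "(\<lambda>s. gradient f x \<bullet> (s *\<^sub>R (y - x))) = (*) (gradient f x \<bullet> (y - x))"
      by (simp add: fun_eq_iff mult.commute)
    ultimately show ?thesis
      by (simp only: has_field_derivative_def)
  qed
  ultimately have "F 1 - F 0 \<ge> gradient f x \<bullet> (y - x) * (1 - 0)"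
    by (intro convex_on_imp_above_tangent[where A = UNIV]) auto
  then show ?thesis
    by (simp add: F_def)
qed

text \<open>The factor \<open>a\<close> may have either sign. This is what lets the equality
  constraints enter a convex Lagrangian, since their multipliers carry no sign.\<close>

lemma convex_on_cmul_affine_fun:
  assumes "affine_fun (f :: 'a::real_vector \<Rightarrow> real)"
  shows "convex_on UNIV (\<lambda>y. a * f y)"
proof -
  obtain l c where l: "linear l" and f: "\<And>x. f x = l x + c"
    using assms by (auto simp: affine_fun_def)
  show ?thesis
    by (rule convex_onI) (simp_all add: f linear_add[OF l] linear_scale[OF l], simp add: algebra_simps)
qed

lemma convex_on_sum_fun:
  assumes "convex A" "\<And>i. i \<in> I \<Longrightarrow> convex_on A (f i)"
  shows "convex_on A (\<lambda>y. \<Sum>i\<in>I. f i y)"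
  using assms(2)
proof (induction I rule: infinite_finite_induct)
  case (insert i I)
  then show ?case
    by (simp add: convex_on_add)
qed (simp_all add: convex_on_const assms(1))

section \<open>Essentially bounded functions\<close>

text \<open>The essential supremum is an almost everywhere bound and lies below every other one, so
  it is below infinity exactly when a real bound exists.\<close>

lemma Linf_iff:
  "x \<in> Linf T \<longleftrightarrow> x \<in> borel_measurable (time_measure T) \<and>
     (\<exists>C. AE t in time_measure T. norm (x t) \<le> C)"
proof (cases "x \<in> borel_measurable (time_measure T)")
  case True
  then have [measurable]: "(\<lambda>t. ereal (norm (x t))) \<in> borel_measurable (time_measure T)"
    by measurable
  have "(\<exists>C. AE t in time_measure T. norm (x t) \<le> C)" if finite: "Linf_norm T x < \<infinity>"
  proof -
    obtain C where C: "Linf_norm T x \<le> ereal C"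
      using finite by (cases "Linf_norm T x") auto
    have "AE t in time_measure T. ereal (norm (x t)) \<le> Linf_norm T x"
      unfolding Linf_norm_def by (rule esssup_AE)
    then have "AE t in time_measure T. norm (x t) \<le> C"
      by eventually_elim (use C order_trans ereal_less_eq(3) in blast)
    then show ?thesis by blast
  qed
  moreover have "Linf_norm T x < \<infinity>" if "AE t in time_measure T. norm (x t) \<le> C" for C
  proof -
    have "Linf_norm T x \<le> ereal C"
      unfolding Linf_norm_def using that by (intro esssup_I) auto
    then show ?thesis by (rule order_le_less_trans) simp
  qed
  ultimately show ?thesis
    using True by (auto simp: Linf_def)
qed (simp add: Linf_def)

lemma Linf_diff:
  assumes "x \<in> Linf T" "y \<in> Linf T"
  shows "(\<lambda>t. x t - y t) \<in> Linf T"
proof -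
  obtain C D where "AE t in time_measure T. norm (x t) \<le> C" "AE t in time_measure T. norm (y t) \<le> D"
    using assms by (auto simp: Linf_iff)
  then have "AE t in time_measure T. norm (x t - y t) \<le> C + D"
  proof eventually_elim
    case (elim t)
    then show ?case using norm_triangle_ineq4[of "x t" "y t"] by linarith
  qed
  then show ?thesis
    using assms by (auto simp: Linf_iff)
qed

section \<open>The Lagrangian: convexity, differentiability and comparison with the
  objective\<close>

lemma Lagrangian_convex:
  assumes "convex_on UNIV (\<lambda>y. \<phi> y t)" "\<And>j. convex_on UNIV (\<lambda>y. g y t $ j)"
    "\<And>i. affine_fun (\<lambda>y. h y t $ i)" "\<And>j. v $ j \<ge> 0"
  shows "convex_on UNIV (\<lambda>y. Lagrangian \<phi> h g y u v t)"
  unfolding Lagrangian_def using assms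
  by (intro convex_on_add convex_on_sum_fun convex_on_cmul convex_on_cmul_affine_fun) auto

lemma Lagrangian_differentiable:
  assumes \<phi>: "continuously_differentiable (\<lambda>y. \<phi> y t)"
    and hg: "continuously_differentiable (\<lambda>y. (h y t, g y t))"
  shows "(\<lambda>y. Lagrangian \<phi> h g y u v t) differentiable (at x)"
proof -
  obtain D where D: "((\<lambda>y. (h y t, g y t)) has_derivative D) (at x)"
    using hg by (auto simp: continuously_differentiable_def)
  have "(\<lambda>y. \<phi> y t) differentiable (at x)"
    using \<phi> by (auto simp: continuously_differentiable_def differentiable_def)
  moreover have "(\<lambda>y. h y t $ i) differentiable (at x)" for i
    using bounded_linear.has_derivative[OF bounded_linear_vec_nth has_derivative_fst[OF D]]
    by (auto simp: differentiable_def)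
  moreover have "(\<lambda>y. g y t $ j) differentiable (at x)" for j
    using bounded_linear.has_derivative[OF bounded_linear_vec_nth has_derivative_snd[OF D]]
    by (auto simp: differentiable_def)
  ultimately show ?thesis
    unfolding Lagrangian_def by (intro derivative_intros) auto
qed

text \<open>Weak duality at a feasible point: the equality terms vanish and the inequality terms are
  nonpositive.\<close>

lemma Lagrangian_le_objective:
  assumes "h y t = 0" "g y t \<le> 0" "\<And>j. v $ j \<ge> 0"
  shows "Lagrangian \<phi> h g y u v t \<le> \<phi> y t"
proof -
  have "(\<Sum>j\<in>UNIV. v $ j * g y t $ j) \<le> 0"
    using assms by (intro sum_nonpos mult_nonneg_nonpos) (auto simp: less_eq_vec_def)
  then show ?thesis
    using assms(1) by (simp add: Lagrangian_def)
qed

section \<open>Comparison of costs and global optimality\<close>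

text \<open>Positive and negative parts are compared separately, so the claim also covers infinite
  integrals.\<close>

lemma cost_mono_AE:
  assumes "AE t in time_measure T. \<phi> (x t) t \<le> \<phi> (y t) t"
  shows "cost T \<phi> x \<le> cost T \<phi> y"
  unfolding cost_def
proof (rule ereal_minus_mono)
  show "enn2ereal (\<integral>\<^sup>+ t. ennreal (\<phi> (x t) t) \<partial>time_measure T)
      \<le> enn2ereal (\<integral>\<^sup>+ t. ennreal (\<phi> (y t) t) \<partial>time_measure T)"
    using assms by (intro less_eq_ennreal.rep_eq[THEN iffD1] nn_integral_mono_AE)
      (auto elim!: eventually_mono intro: ennreal_leI)
  show "enn2ereal (\<integral>\<^sup>+ t. ennreal (- \<phi> (y t) t) \<partial>time_measure T)
      \<le> enn2ereal (\<integral>\<^sup>+ t. ennreal (- \<phi> (x t) t) \<partial>time_measure T)"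
    using assms by (intro less_eq_ennreal.rep_eq[THEN iffD1] nn_integral_mono_AE)
      (auto elim!: eventually_mono intro: ennreal_leI)
qed

theorem theorem3p5:
  fixes T :: real
    and \<phi> :: "real^'n \<Rightarrow> real \<Rightarrow> real"
    and h :: "real^'n \<Rightarrow> real \<Rightarrow> real^'p"
    and g :: "real^'n \<Rightarrow> real \<Rightarrow> real^'m"
    and xb :: "real \<Rightarrow> real^'n"
    and x :: "nat \<Rightarrow> real \<Rightarrow> real^'n"
    and u :: "nat \<Rightarrow> real \<Rightarrow> real^'p"
    and v :: "nat \<Rightarrow> real \<Rightarrow> real^'m"
  assumes "T > 0"
    and "xb \<in> feasible_set T h g"
    and "pw_AKKT_solution T \<phi> h g xb"
    and "associated_AKKT_sequence T \<phi> h g xb x u v"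
    and "basic_assumptions T \<phi> h g xb"
    and "Linf_bounded_seq T x"
    and "\<And>k. AE t in time_measure T.
           (\<Sum>i\<in>UNIV. u k t $ i * h (x k t) t $ i) + (\<Sum>j\<in>UNIV. v k t $ j * g (x k t) t $ j) \<ge> 0"
    and "AE t in time_measure T.
           convex_on UNIV (\<lambda>y. \<phi> y t) \<and>
           (\<forall>j. convex_on UNIV (\<lambda>y. g y t $ j)) \<and>
           (\<forall>i. affine_fun (\<lambda>y. h y t $ i))"
  shows "global_optimal T \<phi> h g xb"
  unfolding global_optimal_def
\<comment> \<open>Optimality is reduced to the stronger pointwise inequality between the integrands,
  almost everywhere.\<close>
proof (intro conjI ballI cost_mono_AE)
  let ?M = "time_measure T"
  fix w assume w: "w \<in> feasible_set T h g"
  interpret finite_measure ?M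
    by (rule finite_measure_lebesgue_on) simp
  define G where "G k t = gradient (\<lambda>y. Lagrangian \<phi> h g y (u k t) (v k t) t) (x k t)" for k t
  have akkt: "AKKT_sequence T \<phi> h g x u v" and lim: "AE t in ?M. (\<lambda>k. x k t) \<longlonglongrightarrow> xb t"
    using assms(4) by (auto simp: associated_AKKT_sequence_def)
  have int: "integrable ?M (\<lambda>t. G k t \<bullet> \<gamma> t)"
    and weak: "(\<lambda>k. \<integral>t. G k t \<bullet> \<gamma> t \<partial>?M) \<longlonglongrightarrow> 0" if "\<gamma> \<in> Linf T" for \<gamma> k
    using akkt that by (auto simp: AKKT_sequence_def G_def)
  have "AE t in ?M. v k t $ j \<ge> 0" for k j
    using akkt by (auto simp: AKKT_sequence_def)
  then have v: "AE t in ?M. \<forall>k j. v k t $ j \<ge> 0"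
    by (auto simp: AE_all_countable)
  have sgn: "AE t in ?M. \<forall>k. (\<Sum>i\<in>UNIV. u k t $ i * h (x k t) t $ i)
      + (\<Sum>j\<in>UNIV. v k t $ j * g (x k t) t $ j) \<ge> 0"
    using assms(7) by (auto simp: AE_all_countable)
  \<comment> \<open>Condition (i) speaks only of pairings. Testing with the constant basis vectors
    gives every coordinate of \<open>G k\<close>, hence \<open>G k\<close> itself.\<close>
  have G_int: "integrable ?M (G k)" for k
  proof -
    have "integrable ?M (\<lambda>t. \<Sum>b\<in>Basis. (G k t \<bullet> b) *\<^sub>R b)"
      by (intro Bochner_Integration.integrable_sum integrable_scaleR_left int) (auto simp: Linf_iff)
    then show ?thesis by (simp add: euclidean_representation)
  qed
  have xL: "x k \<in> Linf T" for k
    using assms(6) by (auto simp: Linf_bounded_seq_def)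
  have L: "w \<in> Linf T" "xb \<in> Linf T"
    using w assms(2) by (auto simp: feasible_set_def)
  obtain C where C: "AE t in ?M. norm (w t - xb t) \<le> C"
    and wxb: "(\<lambda>t. w t - xb t) \<in> borel_measurable ?M"
    using Linf_diff[OF L] by (auto simp: Linf_iff)
  have xbx: "(\<lambda>t. xb t - x k t) \<in> borel_measurable ?M"
    and "\<exists>D. AE t in ?M. norm (xb t - x k t) \<le> D" for k
    using Linf_diff[OF L(2) xL[of k]] by (auto simp: Linf_iff)
  then obtain D where D: "\<And>k. AE t in ?M. norm (xb t - x k t) \<le> D k"
    by metis
  \<comment> \<open>The direction \<open>w t - x k t\<close> is split into a part independent of
    \<open>k\<close>, handled by weak convergence, and a part tending to 0 almost
    everywhere.\<close>
  have "AE t in ?M. \<forall>d>0. \<exists>\<^sub>F k in sequentially. G k t \<bullet> ((w t - xb t) + (xb t - x k t)) > - d"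
  proof (rule weakly_null_limsup_nonneg[OF G_int _ wxb C xbx D])
    show "(\<lambda>k. \<integral>t. G k t \<bullet> \<gamma> t \<partial>?M) \<longlonglongrightarrow> 0"
      if "\<gamma> \<in> borel_measurable ?M" "AE t in ?M. norm (\<gamma> t) \<le> C" for \<gamma> C
      using that by (intro weak) (auto simp: Linf_iff)
    show "AE t in ?M. (\<lambda>k. xb t - x k t) \<longlonglongrightarrow> 0"
      using lim
    proof eventually_elim
      case (elim t)
      then show ?case
        using tendsto_diff[OF tendsto_const elim, of "xb t"] by simp
    qed
  qed
  moreover obtain r where "hyp_H1 T \<phi> xb r" "hyp_H2 T h g xb r"
    using assms(5) by (auto simp: basic_assumptions_def)
  then have "AE t in ?M. continuously_differentiable (\<lambda>y. \<phi> y t)"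
    "AE t in ?M. continuously_differentiable (\<lambda>y. (h y t, g y t))"
    by (auto simp: hyp_H1_def hyp_H2_def)
  moreover have "AE t in ?M. h (w t) t = 0 \<and> g (w t) t \<le> 0"
    using w by (auto simp: feasible_set_def)
  ultimately show "AE t in ?M. \<phi> (xb t) t \<le> \<phi> (w t) t"
    using lim v sgn assms(8)
  proof eventually_elim
    case (elim t)
    have le: "\<phi> (x k t) t + G k t \<bullet> (w t - x k t) \<le> \<phi> (w t) t" for k
    proof -
      let ?L = "\<lambda>y. Lagrangian \<phi> h g y (u k t) (v k t) t"
      \<comment> \<open>This is where the sign assumption on the multiplier terms enters: it
        replaces complementary slackness along the sequence.\<close>
      have "\<phi> (x k t) t \<le> ?L (x k t)"
        using elim(7) by (simp add: Lagrangian_def add.assoc)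
      moreover have "?L (x k t) + G k t \<bullet> (w t - x k t) \<le> ?L (w t)"
        unfolding G_def using elim
        by (intro convex_on_gradient_le Lagrangian_convex Lagrangian_differentiable) auto
      moreover have "?L (w t) \<le> \<phi> (w t) t"
        using elim by (intro Lagrangian_le_objective) auto
      ultimately show ?thesis by linarith
    qed
    have "continuous (at (xb t)) (\<lambda>y. \<phi> y t)"
      using elim(2) by (auto simp: continuously_differentiable_def intro: has_derivative_continuous)
    then have \<phi>_lim: "(\<lambda>k. \<phi> (x k t) t) \<longlonglongrightarrow> \<phi> (xb t) t"
      using elim(5) isCont_tendsto_compose by blast
    show ?case
    proof (rule field_le_epsilon)
      fix e :: real assume "e > 0"
      then have "\<exists>\<^sub>F k in sequentially. G k t \<bullet> ((w t - xb t) + (xb t - x k t)) > - (e/2)"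
        using elim(1) by (meson half_gt_zero)
      moreover have "\<forall>\<^sub>F k in sequentially. \<phi> (x k t) t > \<phi> (xb t) t - e/2"
        using \<phi>_lim \<open>e > 0\<close> by (intro order_tendstoD) auto
      \<comment> \<open>One index is enough, because \<open>le\<close> holds for every
        \<open>k\<close>: a property that holds frequently meets one that holds eventually, each
        losing \<open>e/2\<close>.\<close>
      ultimately obtain k where "G k t \<bullet> ((w t - xb t) + (xb t - x k t)) > - (e/2)"
        "\<phi> (x k t) t > \<phi> (xb t) t - e/2"
        using frequently_eventually_conj frequently_ex by blast
      with le[of k] show "\<phi> (xb t) t \<le> \<phi> (w t) t + e"
        by simp
    qed
  qed
qed (fact assms(2))

end
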